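(* Let $q\ge1$ be an integer and consider, for real $a,b$ with $b\ne0$, the equation (for $t,r\in\mathbb N_0$) $$\partial_t^2U(r;t)=\begin{cases}-(b(q+1)-a)\,U(0;t)+b(q+1)\,U(1;t),& r=0,\\[4pt]-(b(q+1)-a)\,U(r;t)+bq\,U(r+1;t)+b\,U(r-1;t),& r\ge1,\end{cases}\qquad( * )$$ with the initial conditions $$\text{(A)}\quad U(r;0)=\delta_{r,0},\ \ \partial_tU(r;0)=0\ \ \forall r;\qquad\qquad\text{(B)}\quad U(r;0)=0,\ \ \partial_tU(r;0)=\delta_{r,0}\ \ \forall r .$$ (1) For any real $a,b$ with $b\neq0$ and $d_{a,b}:=b(q+1)-a\ne0$, put $c_{a,b}=2b\sqrt q/d_{a,b}$. Then $$W^{a,b}_{q+1}(r;t)=\sum_{k=0}^{\lfloor t/2\rfloor}(-1)^{k+r}\binom{t}{2k}d_{a,b}^k\left(q^{-\frac r2}I_r^{c_{a,b}}(k)-(q-1)\sum_{\ell=1}^{\lfloor\frac{k-r}{2}\rfloor}q^{-\frac{r+2\ell}{2}}I_{r+2\ell}^{c_{a,b}}(k)\right)$$ and $$V^{a,b}_{q+1}(r;t)=\sum_{k=0}^{\lfloor (t-1)/2\rfloor}(-1)^{k+r}\binom{t}{2k+1}d_{a,b}^k\left(q^{-\frac r2}I_r^{c_{a,b}}(k)-(q-1)\sum_{\ell=1}^{\lfloor\frac{k-r}{2}\rfloor}q^{-\frac{r+2\ell}{2}}I_{r+2\ell}^{c_{a,b}}(k)\right)$$ are solutions to $( * )$ with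 initial conditions (A) and (B), respectively. (2) When $a=b(q+1)$ (with $b\ne0$), the solution of $( * )$ satisfying (A) is $$W^{b(q+1),b}_{q+1}(r;t)=b^r\sum_{m=0}^{\lfloor\frac{t-2r}{4}\rfloor}\binom{t}{2r+4m}b^{2m}\sum_{j=0}^mq^j\left(\binom{r+2m}{j}-\binom{r+2m}{j-1}\right),$$ and the solution of $( * )$ satisfying (B) is $$V^{b(q+1),b}_{q+1}(r;t)=b^r\sum_{m=0}^{\lfloor\frac{t-2r-1}{4}\rfloor}\binom{t}{2r+4m+1}b^{2m}\sum_{j=0}^mq^j\left(\binom{r+2m}{j}-\binom{r+2m}{j-1}\right),$$ with the convention $\binom{r+2m}{-1}=0$.
   Context: Equation $( * )$ is the radial form of the discrete wave equation $\Delta_{q+1}^{a,b}U+\partial_t^2U=0$ on the $(q+1)$-regular tree $T_{q+1}$ with root $x_0$, where $r=|x|$ is the graph distance of a vertex $x$ from $x_0$, $\Delta_{q+1}^{a,b}=b\Delta_{T_{q+1}}-aI$ and $\Delta_{T_{q+1}}f(x)=(q+1)f(x)-\sum_{y\sim x}f(y)$. For $t\in\mathbb N_0$, $\partial_tf(t)=f(t+1)-f(t)$ and $\partial_t^2f(t)=f(t+2)-2f(t+1)+f(t)$. $\delta_{r,0}=1$ if $r=0$ and $0$ otherwise. Discrete $I$-Bessel functions: for $t,n\in\mathbb N_0$, $c\in\mathbb C$, $$I^{c}_{n}(t)=\sum_{\ell=0}^{\lfloor (t-n)/2\rfloor}\frac{t!}{\ell!\,(t-2\ell-n)!\,(n+\ell)!}\left(\frac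 c2\right)^{2\ell+n}\ \text{ if } n\le t,\qquad I_n^c(t)=0\ \text{ if } n>t.$$ Empty sums are zero. *)

theory Defs
  imports Complex_Main
begin

definition fdiff :: "(nat \<Rightarrow> real) \<Rightarrow> nat \<Rightarrow> real" where
  "fdiff f t = f (t + 1) - f t"

definition fdiff2 :: "(nat \<Rightarrow> real) \<Rightarrow> nat \<Rightarrow> real" where
  "fdiff2 f t = f (t + 2) - 2 * f (t + 1) + f t"

text \<open>Discrete I-Bessel function; the parameter \<open>c\<close> may be complex, and is used below at
  real \<open>c\<close>.\<close>
definition discrete_I :: "nat \<Rightarrow> 'a::field_char_0 \<Rightarrow> nat \<Rightarrow> 'a" where
  "discrete_I n c t =
     (if n \<le> t
      then \<Sum>l = 0..(t - n) div 2.
             fact t / (fact l * fact (t - 2 * l - n) * fact (n + l)) * (c / 2) ^ (2 * l + n)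
      else 0)"

text \<open>Throughout, \<open>U r t\<close> is the value \<open>U(r;t)\<close> at radius \<open>r\<close> and time \<open>t\<close>.\<close>

definition radial_wave_eq :: "nat \<Rightarrow> real \<Rightarrow> real \<Rightarrow> (nat \<Rightarrow> nat \<Rightarrow> real) \<Rightarrow> bool" where
  "radial_wave_eq q a b U \<longleftrightarrow>
     (\<forall>t r. fdiff2 (U r) t =
        (if r = 0
         then - (b * (real q + 1) - a) * U 0 t + b * (real q + 1) * U 1 t
         else - (b * (real q + 1) - a) * U r t + b * real q * U (r + 1) t + b * U (r - 1) t))"

definition init_A :: "(nat \<Rightarrow> nat \<Rightarrow> real) \<Rightarrow> bool" where
  "init_A U \<longleftrightarrow> (\<forall>r. U r 0 = (if r = 0 then 1 else 0) \<and> fdiff (U r) 0 = 0)"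

definition init_B :: "(nat \<Rightarrow> nat \<Rightarrow> real) \<Rightarrow> bool" where
  "init_B U \<longleftrightarrow> (\<forall>r. U r 0 = 0 \<and> fdiff (U r) 0 = (if r = 0 then 1 else 0))"

definition d_coef :: "nat \<Rightarrow> real \<Rightarrow> real \<Rightarrow> real" where
  "d_coef q a b = b * (real q + 1) - a"

definition c_coef :: "nat \<Rightarrow> real \<Rightarrow> real \<Rightarrow> real" where
  "c_coef q a b = 2 * b * sqrt (real q) / d_coef q a b"

text \<open>Upper summation limits that may be negative are computed in \<open>int\<close>, where \<open>div\<close> is the
  floor of the quotient; a negative limit gives the empty sum.\<close>

definition W_sol :: "nat \<Rightarrow> real \<Rightarrow> real \<Rightarrow> nat \<Rightarrow> nat \<Rightarrow> real" where
  "W_sol q a b r t =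
     (\<Sum>k = 0..t div 2.
        (-1) ^ (k + r) * real (t choose (2 * k)) * d_coef q a b ^ k *
        (real q powr (- (real r / 2)) * discrete_I r (c_coef q a b) k
         - (real q - 1) *
           (\<Sum>l | 1 \<le> l \<and> int l \<le> (int k - int r) div 2.
              real q powr (- (real (r + 2 * l) / 2)) * discrete_I (r + 2 * l) (c_coef q a b) k)))"

definition V_sol :: "nat \<Rightarrow> real \<Rightarrow> real \<Rightarrow> nat \<Rightarrow> nat \<Rightarrow> real" where
  "V_sol q a b r t =
     (\<Sum>k | int k \<le> (int t - 1) div 2.
        (-1) ^ (k + r) * real (t choose (2 * k + 1)) * d_coef q a b ^ k *
        (real q powr (- (real r / 2)) * discrete_I r (c_coef q a b) k
         - (real q - 1) *
           (\<Sum>l | 1 \<le> l \<and> int l \<le> (int k - int r) div 2.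
              real q powr (- (real (r + 2 * l) / 2)) * discrete_I (r + 2 * l) (c_coef q a b) k)))"

text \<open>The closed forms in the degenerate case \<open>a = b (q + 1)\<close>, i.e. \<open>d_coef q a b = 0\<close>.
  The conditional implements the convention that \<open>n choose (-1)\<close> is 0.\<close>

definition W_deg :: "nat \<Rightarrow> real \<Rightarrow> nat \<Rightarrow> nat \<Rightarrow> real" where
  "W_deg q b r t =
     b ^ r * (\<Sum>m | int m \<le> (int t - 2 * int r) div 4.
        real (t choose (2 * r + 4 * m)) * b ^ (2 * m) *
        (\<Sum>j = 0..m. real q ^ j *
           (real ((r + 2 * m) choose j)
            - (if j = 0 then 0 else real ((r + 2 * m) choose (j - 1))))))"

definition V_deg :: "nat \<Rightarrow> real \<Rightarrow> nat \<Rightarrow> nat \<Rightarrow> real" where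
  "V_deg q b r t =
     b ^ r * (\<Sum>m | int m \<le> (int t - 2 * int r - 1) div 4.
        real (t choose (2 * r + 4 * m + 1)) * b ^ (2 * m) *
        (\<Sum>j = 0..m. real q ^ j *
           (real ((r + 2 * m) choose j)
            - (if j = 0 then 0 else real ((r + 2 * m) choose (j - 1))))))"

end

theory Submission
  imports Defs
begin

text \<open>
  The right-hand side of the radial wave equation is \<open>L\<close> applied to \<open>U(\<cdot>;t)\<close>, where
  \<open>L = -d + b A\<close>, \<open>d = b(q+1) - a\<close>, and \<open>A\<close> (called \<open>adj_step\<close> below) is the adjacency operator
  of the tree restricted to radial functions. A linear recurrence \<open>\<partial>\<^sub>t\<^sup>2 U = L U\<close> in discrete
  time is solved by a Newton series, because the second difference of \<open>t choose (i + 2)\<close> in \<open>t\<close> is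
  \<open>t choose i\<close>: with \<open>\<delta>\<close> the delta function at the root, the solution for the initial data (A)
  is \<open>\<Sum>k. (t choose 2k) L\<^sup>k \<delta>\<close> and the one for (B) is \<open>\<Sum>k. (t choose 2k+1) L\<^sup>k \<delta>\<close>
  (lemmas \<open>init_A_solution_iff\<close> and \<open>init_B_solution_iff\<close>). All that remains is to compute
  \<open>L\<^sup>k \<delta>\<close>.

  Since \<open>A\<close> is the adjacency operator, \<open>A\<^sup>n \<delta>\<close> at radius \<open>r\<close> is the number of walks of
  length \<open>n\<close> from the root to a fixed vertex at distance \<open>r\<close>. For \<open>n = r + 2m\<close> it equals
  \<open>\<Sum>j\<le>m. q\<^sup>j ((n choose j) - (n choose j-1))\<close>, by Pascal's rule away from the root and by the
  symmetry of the middle binomial coefficients at the root (lemma \<open>walks_eq_ballot_sum\<close>); it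
  vanishes for all other \<open>n\<close>. The binomial theorem for \<open>-d + b A\<close> then gives \<open>L\<^sup>k \<delta>\<close>
  (lemma \<open>wave_iterate_binomial\<close>).

  If \<open>d = 0\<close>, only the term \<open>b\<^sup>k A\<^sup>k \<delta>\<close> survives, which is part (2). If \<open>d \<noteq> 0\<close>, summation by
  parts turns the number of walks into
  \<open>q\<^sup>m (n choose m) - (q - 1) \<Sum>j<m. q\<^sup>j (n choose j)\<close>. The multinomial coefficient in the
  discrete Bessel function factors as \<open>(k choose n) (n choose j)\<close>, so each summand \<open>l\<close> of the
  Bessel expression in part (1) collects precisely the terms with \<open>j = m - l\<close>
  (lemma \<open>wave_iterate_eq_discrete_I\<close>).
\<close>

section \<open>The radial operator and its iterates\<close>

text \<open>
  A vertex other than the root has \<open>q\<close> neighbours further out and one further in, while all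
  \<open>q + 1\<close> neighbours of the root are further out.
\<close>

definition adj_step :: "nat \<Rightarrow> (nat \<Rightarrow> real) \<Rightarrow> nat \<Rightarrow> real" where
  "adj_step q u r =
     (if r = 0 then (real q + 1) * u 1 else real q * u (r + 1) + u (r - 1))"

definition wave_step :: "nat \<Rightarrow> real \<Rightarrow> real \<Rightarrow> (nat \<Rightarrow> real) \<Rightarrow> nat \<Rightarrow> real" where
  "wave_step q a b u r = - d_coef q a b * u r + b * adj_step q u r"

definition root_delta :: "nat \<Rightarrow> real" where
  "root_delta r = (if r = 0 then 1 else 0)"

definition walks :: "nat \<Rightarrow> nat \<Rightarrow> nat \<Rightarrow> real" where
  "walks q n = (adj_step q ^^ n) root_delta"

definition wave_iterate :: "nat \<Rightarrow> real \<Rightarrow> real \<Rightarrow> nat \<Rightarrow> nat \<Rightarrow> real" where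
  "wave_iterate q a b k = (wave_step q a b ^^ k) root_delta"

lemma walks_0: "walks q 0 = root_delta"
  and walks_Suc: "walks q (Suc n) = adj_step q (walks q n)"
  by (simp_all add: walks_def)

lemma wave_iterate_0: "wave_iterate q a b 0 = root_delta"
  and wave_iterate_Suc: "wave_iterate q a b (Suc k) = wave_step q a b (wave_iterate q a b k)"
  by (simp_all add: wave_iterate_def)

lemma radial_wave_eq_iff:
  "radial_wave_eq q a b U \<longleftrightarrow> (\<forall>t r. fdiff2 (U r) t = wave_step q a b (\<lambda>s. U s t) r)"
  unfolding radial_wave_eq_def wave_step_def adj_step_def d_coef_def
  by (intro iff_allI) (auto simp: algebra_simps)

lemma adj_step_sum:
  "adj_step q (\<lambda>s. \<Sum>i\<in>A. c i * f i s) r = (\<Sum>i\<in>A. c i * adj_step q (f i) r)"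
  by (simp add: adj_step_def sum_distrib_left sum.distrib algebra_simps)

lemma wave_step_sum:
  "wave_step q a b (\<lambda>s. \<Sum>i\<in>A. c i * f i s) r = (\<Sum>i\<in>A. c i * wave_step q a b (f i) r)"
  by (simp add: wave_step_def adj_step_sum sum_distrib_left sum.distrib sum_negf algebra_simps
        flip: sum_subtractf)

section \<open>Solving in time by Newton series\<close>

text \<open>
  The offset \<open>e\<close> selects the parity of the lower index: \<open>e = 0\<close> serves the initial conditions (A)
  and \<open>e = 1\<close> the conditions (B). Terms with \<open>k > t div 2\<close> vanish, and stopping at \<open>t\<close> avoids a
  truncation that depends on \<open>e\<close>.
\<close>

definition newton_series :: "nat \<Rightarrow> (nat \<Rightarrow> nat \<Rightarrow> real) \<Rightarrow> nat \<Rightarrow> nat \<Rightarrow> real" where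
  "newton_series e K r t = (\<Sum>k\<le>t. real (t choose (2 * k + e)) * K k r)"

text \<open>
  Applying a difference in \<open>t\<close> requires a common summation range for several times.
\<close>

lemma newton_series_extend:
  assumes "t \<le> N"
  shows "newton_series e K r t = (\<Sum>k\<le>N. real (t choose (2 * k + e)) * K k r)"
  unfolding newton_series_def
  by (rule sum.mono_neutral_left) (use assms in \<open>auto simp: not_le\<close>)

lemma fdiff2_binomial:
  "real (t + 2 choose (i + 2)) - 2 * real (t + 1 choose (i + 2)) + real (t choose (i + 2))
   = real (t choose i)"
  by (simp add: numeral_2_eq_2)

text \<open>
  Taking the second difference shifts the series by one index \<open>k\<close>, and so does applying
  \<open>wave_step\<close>. The bound on \<open>e\<close> makes the leading coefficient \<open>t choose e\<close> affine in \<open>t\<close>, so that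
  its second difference is zero.
\<close>

lemma newton_series_solves:
  assumes "e \<le> 1"
  shows "radial_wave_eq q a b (newton_series e (wave_iterate q a b))"
  unfolding radial_wave_eq_iff
proof (intro allI)
  fix t r
  let ?K = "wave_iterate q a b"
  let ?D = "\<lambda>i. real (t + 2 choose i) - 2 * real (t + 1 choose i) + real (t choose i)"
  have e: "e = 0 \<or> e = 1" using assms by auto
  have "fdiff2 (newton_series e ?K r) t = (\<Sum>k\<le>Suc (Suc t). ?D (2 * k + e) * ?K k r)"
    unfolding fdiff2_def
    by (simp add: newton_series_extend[of _ "Suc (Suc t)"] sum_distrib_left sum.distrib sum_subtractf
          algebra_simps del: sum.atMost_Suc binomial_Suc_Suc)
  also have "\<dots> = ?D e * ?K 0 r + (\<Sum>k\<le>Suc t. ?D (2 * k + e + 2) * ?K (Suc k) r)"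
    by (subst sum.atMost_Suc_shift) (simp add: algebra_simps)
  also have "?D e = 0"
    using e by auto
  also have "(\<Sum>k\<le>Suc t. ?D (2 * k + e + 2) * ?K (Suc k) r)
      = (\<Sum>k\<le>Suc t. real (t choose (2 * k + e)) * wave_step q a b (?K k) r)"
    unfolding fdiff2_binomial wave_iterate_Suc ..
  also have "\<dots> = wave_step q a b (\<lambda>s. \<Sum>k\<le>Suc t. real (t choose (2 * k + e)) * ?K k s) r"
    unfolding wave_step_sum ..
  also have "\<dots> = wave_step q a b (\<lambda>s. newton_series e ?K s t) r"
    by (simp only: newton_series_extend[of t "Suc t"] le_SucI[OF order.refl])
  finally show "fdiff2 (newton_series e ?K r) t = wave_step q a b (\<lambda>s. newton_series e ?K s t) r"
    by simp
qed

lemma newton_series_init_A: "init_A (newton_series 0 (wave_iterate q a b))"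
  by (simp add: init_A_def fdiff_def newton_series_def wave_iterate_0 root_delta_def)

lemma newton_series_init_B: "init_B (newton_series 1 (wave_iterate q a b))"
  by (simp add: init_B_def fdiff_def newton_series_def wave_iterate_0 root_delta_def)

text \<open>
  The equation determines \<open>U(\<cdot>;t+2)\<close> from the values at times \<open>t\<close> and \<open>t+1\<close>.
\<close>

lemma radial_wave_eq_unique:
  assumes "radial_wave_eq q a b U" "radial_wave_eq q a b V"
    and "\<And>r. U r 0 = V r 0" "\<And>r. fdiff (U r) 0 = fdiff (V r) 0"
  shows "U = V"
proof -
  have "(\<forall>r. U r t = V r t) \<and> (\<forall>r. U r (Suc t) = V r (Suc t))" for t
  proof (induction t)
    case 0
    then show ?case using assms(3,4) by (simp add: fdiff_def)
  next
    case (Suc t)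
    then have "(\<lambda>s. U s t) = (\<lambda>s. V s t)" by auto
    then have "fdiff2 (U r) t = fdiff2 (V r) t" for r
      using assms(1,2) by (simp add: radial_wave_eq_iff)
    then show ?case using Suc by (simp add: fdiff2_def)
  qed
  then show ?thesis by auto
qed

lemma init_A_solution_iff:
  "radial_wave_eq q a b U \<and> init_A U \<longleftrightarrow> U = newton_series 0 (wave_iterate q a b)"
proof
  assume U: "radial_wave_eq q a b U \<and> init_A U"
  show "U = newton_series 0 (wave_iterate q a b)"
    by (rule radial_wave_eq_unique[of q a b])
       (use U newton_series_solves[of 0 q a b] newton_series_init_A[of q a b]
        in \<open>simp_all add: init_A_def\<close>)
qed (simp add: newton_series_solves newton_series_init_A[simplified])

lemma init_B_solution_iff:
  "radial_wave_eq q a b U \<and> init_B U \<longleftrightarrow> U = newton_series 1 (wave_iterate q a b)"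
proof
  assume U: "radial_wave_eq q a b U \<and> init_B U"
  show "U = newton_series 1 (wave_iterate q a b)"
    by (rule radial_wave_eq_unique[of q a b])
       (use U newton_series_solves[of 1 q a b] newton_series_init_B[of q a b]
        in \<open>simp_all add: init_B_def\<close>)
qed (simp add: newton_series_solves newton_series_init_B[simplified])

section \<open>Counting walks on the tree\<close>

text \<open>
  The differences of consecutive binomial coefficients are ballot numbers: the coefficient of
  \<open>q\<^sup>j\<close> counts sequences of \<open>n\<close> up and down steps, \<open>j\<close> of them up, in which no initial segment has
  more up steps than down steps (for \<open>2j \<le> n\<close>).
\<close>

definition ballot_sum :: "nat \<Rightarrow> nat \<Rightarrow> nat \<Rightarrow> real" where
  "ballot_sum q n m = (\<Sum>j = 0..m. real q ^ j *
     (real (n choose j) - (if j = 0 then 0 else real (n choose (j - 1)))))"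

lemma ballot_sum_0: "ballot_sum q n 0 = 1"
  by (simp add: ballot_sum_def)

lemma ballot_sum_Suc:
  "ballot_sum q n (Suc m) =
     ballot_sum q n m + real q ^ Suc m * (real (n choose Suc m) - real (n choose m))"
  by (simp add: ballot_sum_def)

text \<open>
  This is Pascal's rule summed against \<open>q\<^sup>j\<close>; it matches the recursion
  \<open>A\<^sup>n\<^sup>+\<^sup>1 \<delta>(r) = q A\<^sup>n \<delta>(r+1) + A\<^sup>n \<delta>(r-1)\<close> away from the root.
\<close>

lemma ballot_sum_pascal:
  "ballot_sum q (Suc n) (Suc m) = real q * ballot_sum q n m + ballot_sum q n (Suc m)"
proof (induction m)
  case 0
  then show ?case by (simp add: ballot_sum_Suc ballot_sum_0 algebra_simps)
next
  case (Suc m)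
  have "ballot_sum q (Suc n) (Suc (Suc m)) = real q * ballot_sum q n m + ballot_sum q n (Suc m)
      + real q ^ Suc (Suc m) * (real (n choose Suc (Suc m)) - real (n choose m))"
    by (simp add: ballot_sum_Suc[of q "Suc n" "Suc m"] Suc.IH)
  then show ?case
    by (simp add: ballot_sum_Suc[of q n "Suc m"] ballot_sum_Suc[of q n m] algebra_simps)
qed

text \<open>
  At the root the factor is \<open>q + 1\<close> and there is no inner neighbour. The general recursion gives
  this all the same: the top summand of its second term contains the difference of the two equal
  middle coefficients of an odd row, so that both terms are the same ballot sum.
\<close>

lemma ballot_sum_middle:
  "ballot_sum q (2 * m + 2) (m + 1) = (real q + 1) * ballot_sum q (2 * m + 1) m"
proof -
  have "2 * m + 1 choose (Suc m) = (2 * m + 1 choose m)"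
    using binomial_symmetric[of m "2 * m + 1"] by simp
  then have "ballot_sum q (2 * m + 1) (Suc m) = ballot_sum q (2 * m + 1) m"
    by (simp only: ballot_sum_Suc) simp
  then show ?thesis
    using ballot_sum_pascal[of q "2 * m + 1" m] by (simp add: algebra_simps)
qed

lemma walks_eq_ballot_sum:
  "walks q n r = (if r \<le> n \<and> even (n - r) then ballot_sum q n ((n - r) div 2) else 0)"
proof (induction n arbitrary: r)
  case 0
  then show ?case by (auto simp: walks_0 root_delta_def ballot_sum_0)
next
  case (Suc n)
  have step: "walks q (Suc n) r =
      (if r = 0 then (real q + 1) * walks q n 1 else real q * walks q n (r + 1) + walks q n (r - 1))"
    by (simp only: walks_Suc adj_step_def)
  show ?case
  proof (cases "r \<le> Suc n \<and> even (Suc n - r)")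
    case False
    then show ?thesis unfolding step by (auto simp: Suc.IH)
  next
    case True
    then obtain m where m: "Suc n = r + 2 * m"
      by (metis dvdE le_add_diff_inverse)
    consider "m = 0" "r = Suc n" | p where "r = 0" "n = 2 * p + 1" "m = Suc p"
      | p s where "r = Suc s" "n = s + 2 * Suc p" "m = Suc p"
      using m by (cases m; cases r) auto
    then show ?thesis
    proof cases
      case 1
      then show ?thesis unfolding step by (simp add: Suc.IH ballot_sum_0)
    next
      case 2
      have "walks q n 1 = ballot_sum q (2 * p + 1) p"
        by (simp add: Suc.IH) (simp add: 2)
      moreover have "Suc n = 2 * p + 2" using 2 by simp
      ultimately show ?thesis
        unfolding step using 2(1) ballot_sum_middle[of q p] by (simp del: binomial_Suc_Suc)
    next
      case (3 p s)
      have diffs: "Suc n - r = 2 * Suc p" "n - (r + 1) = 2 * p" "n - (r - 1) = 2 * Suc p"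
        "r + 1 \<le> n" "r - 1 \<le> n" "r \<le> Suc n" "r \<noteq> 0" using 3 by auto
      have "walks q n (r + 1) = ballot_sum q n p" "walks q n (r - 1) = ballot_sum q n (Suc p)"
        unfolding Suc.IH using diffs by simp_all
      then show ?thesis
        unfolding step using diffs ballot_sum_pascal[of q n p] by simp
    qed
  qed
qed

text \<open>
  Summation by parts: shifting \<open>j\<close> in the subtracted terms combines \<open>q\<^sup>j\<close> and \<open>q\<^sup>j\<^sup>+\<^sup>1\<close> into
  \<open>(1 - q) q\<^sup>j\<close>, which is where the factor \<open>q - 1\<close> of the Bessel formula comes from.
\<close>

lemma ballot_sum_abel:
  "ballot_sum q n m =
     real q ^ m * real (n choose m) - (real q - 1) * (\<Sum>j<m. real q ^ j * real (n choose j))"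
  by (induction m) (simp_all add: ballot_sum_0 ballot_sum_Suc algebra_simps)

text \<open>
  Parity and distance restrict a walk ending at radius \<open>r\<close> to the lengths \<open>r + 2m\<close>.
\<close>

lemma sum_over_walks:
  assumes "finite N" and M: "\<And>m. m \<in> M \<longleftrightarrow> r + 2 * m \<in> N"
  shows "(\<Sum>n\<in>N. g n * walks q n r) = (\<Sum>m\<in>M. g (r + 2 * m) * ballot_sum q (r + 2 * m) m)"
proof -
  have "(\<Sum>n\<in>N. g n * walks q n r) = (\<Sum>n\<in>(\<lambda>m. r + 2 * m) ` M. g n * walks q n r)"
  proof (rule sum.mono_neutral_right)
    show "\<forall>n\<in>N - (\<lambda>m. r + 2 * m) ` M. g n * walks q n r = 0"
    proof
      fix n assume n: "n \<in> N - (\<lambda>m. r + 2 * m) ` M"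
      have "\<not> (r \<le> n \<and> even (n - r))"
      proof
        assume "r \<le> n \<and> even (n - r)"
        then have "n = r + 2 * ((n - r) div 2)"
          using dvd_mult_div_cancel[of 2 "n - r"] by linarith
        then show False using n M[of "(n - r) div 2"] by (metis DiffD1 DiffD2 imageI)
      qed
      then show "g n * walks q n r = 0" by (auto simp: walks_eq_ballot_sum)
    qed
  qed (use assms in auto)
  also have "\<dots> = (\<Sum>m\<in>M. g (r + 2 * m) * ballot_sum q (r + 2 * m) m)"
    by (subst sum.reindex) (auto simp: inj_on_def walks_eq_ballot_sum)
  finally show ?thesis .
qed

section \<open>The two closed forms\<close>

text \<open>
  The binomial theorem for the operator \<open>-d + b A\<close>, whose two summands commute.
\<close>

lemma wave_iterate_binomial:
  "wave_iterate q a b k r =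
     (\<Sum>n\<le>k. real (k choose n) * (- d_coef q a b) ^ (k - n) * b ^ n * walks q n r)"
proof (induction k arbitrary: r)
  case 0
  then show ?case by (simp add: wave_iterate_0 walks_0)
next
  case (Suc k)
  let ?d = "- d_coef q a b"
  let ?w = "\<lambda>n. walks q n r"
  have "wave_iterate q a b k =
      (\<lambda>s. \<Sum>n\<le>k. (real (k choose n) * ?d ^ (k - n) * b ^ n) * walks q n s)"
    using Suc.IH by auto
  then have "wave_iterate q a b (Suc k) r =
      ?d * (\<Sum>n\<le>k. real (k choose n) * ?d ^ (k - n) * b ^ n * ?w n)
      + b * (\<Sum>n\<le>k. real (k choose n) * ?d ^ (k - n) * b ^ n * ?w (Suc n))"
    unfolding wave_iterate_Suc wave_step_def
    by (simp only: adj_step_sum walks_Suc)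
  also have "?d * (\<Sum>n\<le>k. real (k choose n) * ?d ^ (k - n) * b ^ n * ?w n)
      = (\<Sum>n\<le>Suc k. real (k choose n) * ?d ^ (Suc k - n) * b ^ n * ?w n)"
    by (simp add: sum_distrib_left Suc_diff_le mult_ac)
  also have "\<dots> = ?d ^ Suc k * ?w 0
      + (\<Sum>n\<le>k. real (k choose Suc n) * ?d ^ (k - n) * b ^ Suc n * ?w (Suc n))"
    by (subst sum.atMost_Suc_shift) simp
  also have "b * (\<Sum>n\<le>k. real (k choose n) * ?d ^ (k - n) * b ^ n * ?w (Suc n))
      = (\<Sum>n\<le>k. real (k choose n) * ?d ^ (k - n) * b ^ Suc n * ?w (Suc n))"
    by (simp add: sum_distrib_left mult_ac)
  also have "?d ^ Suc k * ?w 0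
      + (\<Sum>n\<le>k. real (k choose Suc n) * ?d ^ (k - n) * b ^ Suc n * ?w (Suc n))
      + (\<Sum>n\<le>k. real (k choose n) * ?d ^ (k - n) * b ^ Suc n * ?w (Suc n))
      = (\<Sum>n\<le>Suc k. real (Suc k choose n) * ?d ^ (Suc k - n) * b ^ n * ?w n)"
    by (subst sum.atMost_Suc_shift) (simp add: sum.distrib algebra_simps)
  finally show ?case .
qed

lemma wave_iterate_degenerate:
  assumes "d_coef q a b = 0"
  shows "wave_iterate q a b k r = b ^ k * walks q k r"
proof -
  have "wave_iterate q a b k r = (\<Sum>n\<le>k. if n = k then b ^ k * walks q k r else 0)"
    unfolding wave_iterate_binomial by (rule sum.cong) (auto simp: assms)
  then show ?thesis by simp
qed

lemma newton_series_degenerate: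
  assumes "d_coef q a b = 0"
  shows "newton_series e (wave_iterate q a b) r t =
    b ^ r * (\<Sum>m | int m \<le> (int t - 2 * int r - int e) div 4.
      real (t choose (2 * r + 4 * m + e)) * b ^ (2 * m) * ballot_sum q (r + 2 * m) m)"
proof -
  let ?M = "{m. int m \<le> (int t - 2 * int r - int e) div 4}"
  let ?g = "\<lambda>k. real (t choose (2 * k + e)) * b ^ k"
  have M: "m \<in> ?M \<longleftrightarrow> r + 2 * m \<in> {k. 2 * k + e \<le> t}" for m by auto
  have "newton_series e (wave_iterate q a b) r t = (\<Sum>k\<le>t. ?g k * walks q k r)"
    by (simp add: newton_series_def wave_iterate_degenerate[OF assms] mult_ac)
  also have "\<dots> = (\<Sum>k | 2 * k + e \<le> t. ?g k * walks q k r)"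
    by (rule sum.mono_neutral_right) auto
  also have "\<dots> = (\<Sum>m\<in>?M. ?g (r + 2 * m) * ballot_sum q (r + 2 * m) m)"
  proof (rule sum_over_walks)
    show "finite {k. 2 * k + e \<le> t}" by (rule finite_subset[of _ "{..t}"]) auto
  qed (use M in auto)
  finally show ?thesis
    by (simp add: sum_distrib_left power_add algebra_simps)
qed

text \<open>
  The argument \<open>c = 2b\<surd>q / d\<close> is chosen so that \<open>d\<^sup>k (c/2)\<^sup>n = d\<^sup>k\<^sup>-\<^sup>n (b\<surd>q)\<^sup>n\<close>; the power of
  \<open>\<surd>q\<close> left after multiplication with \<open>q powr (- s / 2)\<close> is \<open>q\<^sup>l\<close>, and
  \<open>k! / (l! (k - 2l - s)! (l + s)!)\<close> is the product of \<open>k choose (s + 2l)\<close> and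
  \<open>(s + 2l) choose l\<close>. The result has the shape of the terms in the binomial expansion.
\<close>

lemma rescaled_discrete_I:
  assumes "q \<ge> 1" "d_coef q a b \<noteq> 0" "s \<le> k"
  shows "(-1) ^ (k + s) * d_coef q a b ^ k * (real q powr (- (real s / 2)) * discrete_I s (c_coef q a b) k)
    = (\<Sum>l\<le>(k - s) div 2. real (k choose (s + 2 * l)) * (- d_coef q a b) ^ (k - (s + 2 * l))
         * b ^ (s + 2 * l) * (real q ^ l * real (s + 2 * l choose l)))"
proof -
  let ?d = "d_coef q a b"
  have summand: "(-1) ^ (k + s) * ?d ^ k * (real q powr (- (real s / 2)) *
      (fact k / (fact l * fact (k - 2 * l - s) * fact (s + l)) * (c_coef q a b / 2) ^ (2 * l + s)))
     = real (k choose (s + 2 * l)) * (- ?d) ^ (k - (s + 2 * l))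
         * b ^ (s + 2 * l) * (real q ^ l * real (s + 2 * l choose l))"
    if l: "l \<le> (k - s) div 2" for l
  proof -
    have le: "s + 2 * l \<le> k" using l assms(3) by auto
    define p where "p = k - (s + 2 * l)"
    have k: "k = p + (s + 2 * l)" using le by (simp add: p_def)
    have diffs: "k - 2 * l - s = p" "s + 2 * l - l = s + l" "k - (s + 2 * l) = p" by (simp_all add: k)
    have "real (k choose (s + 2 * l)) = fact k / (fact (s + 2 * l) * fact p)"
      using le by (simp add: binomial_fact diffs)
    moreover have "real (s + 2 * l choose l) = fact (s + 2 * l) / (fact l * fact (s + l))"
      by (simp add: binomial_fact diffs)
    ultimately have multinomial: "fact k / (fact l * fact (k - 2 * l - s) * fact (s + l))
        = real (k choose (s + 2 * l)) * real (s + 2 * l choose l)"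
      unfolding diffs by simp
    have "real q powr (- (real s / 2)) * sqrt (real q) ^ (2 * l + s) = real q ^ l"
    proof -
      have "sqrt (real q) ^ s = sqrt (real q) powr real s"
        using assms(1) by (simp add: powr_realpow)
      also have "\<dots> = real q powr (real s / 2)"
        by (simp add: powr_half_sqrt[symmetric] powr_powr)
      finally show ?thesis
        using assms(1) by (simp add: power_add power_mult powr_minus)
    qed
    moreover have "(-1) ^ (k + s) * ?d ^ k * (c_coef q a b / 2) ^ (2 * l + s)
        = (- ?d) ^ p * b ^ (s + 2 * l) * sqrt (real q) ^ (2 * l + s)"
    proof -
      have "(c_coef q a b / 2) ^ (2 * l + s) = (b * sqrt (real q)) ^ (2 * l + s) / ?d ^ (2 * l + s)"
        by (simp add: c_coef_def power_divide)
      moreover have "(-1) ^ (k + s) = (-1 :: real) ^ p"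
      proof -
        have "k + s = p + 2 * (s + l)" by (simp add: k)
        then show ?thesis by (simp add: power_add power_mult)
      qed
      moreover have "?d ^ k = ?d ^ p * ?d ^ (2 * l + s)"
        unfolding k by (simp add: power_add mult_ac)
      ultimately show ?thesis
        using assms(2)
        by (simp add: power_mult_distrib power_minus[of ?d] add.commute[of s])
    qed
    ultimately show ?thesis
      unfolding multinomial p_def[symmetric] by (simp add: algebra_simps)
  qed
  have "discrete_I s (c_coef q a b) k = (\<Sum>l\<le>(k - s) div 2.
      fact k / (fact l * fact (k - 2 * l - s) * fact (s + l)) * (c_coef q a b / 2) ^ (2 * l + s))"
    using assms(3) by (simp add: discrete_I_def atLeast0AtMost)
  then show ?thesis
    by (simp only: sum_distrib_left) (rule sum.cong, simp, rule summand, simp)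
qed

text \<open>
  The Bessel function of order \<open>r + 2l\<close> contributes to walks of length \<open>r + 2m\<close> the single term
  \<open>j = m - l\<close> of the sum obtained by parts: order \<open>r\<close> gives the boundary term \<open>j = m\<close>, and the
  orders with \<open>l \<ge> 1\<close> give the terms with \<open>j < m\<close>.
\<close>

lemma wave_iterate_eq_discrete_I:
  assumes "q \<ge> 1" "d_coef q a b \<noteq> 0"
  shows "(-1) ^ (k + r) * d_coef q a b ^ k *
      (real q powr (- (real r / 2)) * discrete_I r (c_coef q a b) k
        - (real q - 1) *
           (\<Sum>l | 1 \<le> l \<and> int l \<le> (int k - int r) div 2.
              real q powr (- (real (r + 2 * l) / 2)) * discrete_I (r + 2 * l) (c_coef q a b) k))
    = wave_iterate q a b k r"
proof (cases "r \<le> k")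
  case False
  then have "{l. 1 \<le> l \<and> int l \<le> (int k - int r) div 2} = {}" by auto
  moreover have "wave_iterate q a b k r = 0"
    unfolding wave_iterate_binomial using False by (intro sum.neutral) (auto simp: walks_eq_ballot_sum)
  ultimately show ?thesis using False by (simp add: discrete_I_def)
next
  case True
  define M where "M = (k - r) div 2"
  define g where "g n = real (k choose n) * (- d_coef q a b) ^ (k - n) * b ^ n" for n
  define B where "B s = real q powr (- (real s / 2)) * discrete_I s (c_coef q a b) k" for s
  define p where "p n j = real q ^ j * real (n choose j)" for n j
  let ?s = "(-1) ^ (k + r) * d_coef q a b ^ k"
  have range: "{l. 1 \<le> l \<and> int l \<le> (int k - int r) div 2} = {1..M}"
    using True by (auto simp: M_def)
  have B: "?s * B (r + 2 * l) = (\<Sum>j\<le>M - l. g (r + 2 * (l + j)) * p (r + 2 * (l + j)) j)"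
    if "l \<le> M" for l
  proof -
    have le: "r + 2 * l \<le> k" using that True by (auto simp: M_def)
    have "(k - (r + 2 * l)) div 2 = M - l" by (simp add: M_def)
    moreover have "(-1 :: real) ^ (k + r) = (-1) ^ (k + (r + 2 * l))" by (simp add: power_add)
    ultimately show ?thesis
      using rescaled_discrete_I[OF assms le]
      by (simp add: B_def g_def p_def algebra_simps)
  qed
  have "?s * (\<Sum>l\<in>{1..M}. B (r + 2 * l))
      = (\<Sum>l\<in>{1..M}. \<Sum>j\<le>M - l. g (r + 2 * (l + j)) * p (r + 2 * (l + j)) j)"
    by (simp add: sum_distrib_left B)
  \<comment> \<open>Regroup by \<open>m = l + j\<close>, half the excess of the walk length over \<open>r\<close>.\<close>
  also have "\<dots> = (\<Sum>m\<le>M. \<Sum>j<m. g (r + 2 * m) * p (r + 2 * m) j)"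
    by (simp add: sum.Sigma)
       (rule sum.reindex_bij_witness[of _ "\<lambda>(m, j). (m - j, j)" "\<lambda>(l, j). (l + j, j)"]; auto)
  finally have tail: "?s * (\<Sum>l\<in>{1..M}. B (r + 2 * l))
      = (\<Sum>m\<le>M. g (r + 2 * m) * (\<Sum>j<m. p (r + 2 * m) j))"
    by (simp add: sum_distrib_left)
  have "?s * (B r - (real q - 1) * (\<Sum>l\<in>{1..M}. B (r + 2 * l)))
      = ?s * B r - (real q - 1) * (?s * (\<Sum>l\<in>{1..M}. B (r + 2 * l)))"
    by (simp add: algebra_simps)
  also have "\<dots> = (\<Sum>m\<le>M. g (r + 2 * m) * ballot_sum q (r + 2 * m) m)"
    unfolding tail using B[of 0]
    by (simp add: ballot_sum_abel p_def sum_distrib_left sum_subtractf sum.distrib algebra_simps)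
  also have "\<dots> = (\<Sum>n\<le>k. g n * walks q n r)"
    by (rule sum_over_walks[symmetric]) (use True in \<open>auto simp: g_def M_def\<close>)
  also have "\<dots> = wave_iterate q a b k r"
    by (simp add: wave_iterate_binomial g_def)
  finally show ?thesis
    unfolding range B_def .
qed

lemma W_sol_eq_newton_series:
  assumes "q \<ge> 1" "d_coef q a b \<noteq> 0"
  shows "W_sol q a b = newton_series 0 (wave_iterate q a b)"
proof (intro ext)
  fix r t
  have "W_sol q a b r t = (\<Sum>k = 0..t div 2. real (t choose (2 * k)) * wave_iterate q a b k r)"
    unfolding W_sol_def wave_iterate_eq_discrete_I[OF assms, symmetric]
    by (simp add: mult_ac)
  also have "\<dots> = newton_series 0 (wave_iterate q a b) r t"
    unfolding newton_series_def by (rule sum.mono_neutral_cong_left) auto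
  finally show "W_sol q a b r t = newton_series 0 (wave_iterate q a b) r t" .
qed

lemma V_sol_eq_newton_series:
  assumes "q \<ge> 1" "d_coef q a b \<noteq> 0"
  shows "V_sol q a b = newton_series 1 (wave_iterate q a b)"
proof (intro ext)
  fix r t
  have "V_sol q a b r t =
      (\<Sum>k | int k \<le> (int t - 1) div 2. real (t choose (2 * k + 1)) * wave_iterate q a b k r)"
    unfolding V_sol_def wave_iterate_eq_discrete_I[OF assms, symmetric]
    by (simp add: mult_ac)
  also have "\<dots> = newton_series 1 (wave_iterate q a b) r t"
    unfolding newton_series_def by (rule sum.mono_neutral_cong_left) auto
  finally show "V_sol q a b r t = newton_series 1 (wave_iterate q a b) r t" .
qed

theorem proposition7p1:
  fixes q :: nat and a b :: real
  assumes "q \<ge> 1" and "b \<noteq> 0"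
  shows "(d_coef q a b \<noteq> 0 \<longrightarrow>
            (radial_wave_eq q a b (W_sol q a b) \<and> init_A (W_sol q a b)) \<and>
            (radial_wave_eq q a b (V_sol q a b) \<and> init_B (V_sol q a b)))
       \<and> (a = b * (real q + 1) \<longrightarrow>
            (\<forall>U. radial_wave_eq q a b U \<and> init_A U \<longleftrightarrow> U = W_deg q b) \<and>
            (\<forall>U. radial_wave_eq q a b U \<and> init_B U \<longleftrightarrow> U = V_deg q b))"
proof -
  have "W_deg q b = newton_series 0 (wave_iterate q a b)"
    and "V_deg q b = newton_series 1 (wave_iterate q a b)" if "a = b * (real q + 1)"
  proof -
    have "d_coef q a b = 0" using that by (simp add: d_coef_def)
    note deg = newton_series_degenerate[OF this]
    show "W_deg q b = newton_series 0 (wave_iterate q a b)"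
      by (intro ext) (simp add: deg W_deg_def ballot_sum_def)
    show "V_deg q b = newton_series 1 (wave_iterate q a b)"
      by (intro ext) (simp add: deg V_deg_def ballot_sum_def)
  qed
  then show ?thesis
    unfolding init_A_solution_iff init_B_solution_iff
    using W_sol_eq_newton_series[OF assms(1)] V_sol_eq_newton_series[OF assms(1)] by simp
qed

end
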